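(* For every integer $n\geq 8$ there exists an almost 2-perfect (A2P) maximum 8-cycle packing of $K_n$.
   Context: An 8-cycle packing of $K_n$ on an $n$-element vertex set $\mathcal{X}$ is a triple $(\mathcal{X},\mathcal{C},\mathcal{L})$ where $\mathcal{C}$ is a collection of pairwise edge-disjoint 8-cycles of $K_n$ and the leave $\mathcal{L}$ is the set of edges of $K_n$ lying in no cycle of $\mathcal{C}$. It is a maximum packing if $|\mathcal{L}|$ is as small as possible among all 8-cycle packings of $K_n$. For an 8-cycle $C$, an inside 8-cycle of $C$ is an 8-cycle on the same vertex set as $C$ sharing no edge with $C$. The packing $(\mathcal{X},\mathcal{C},\mathcal{L})$ is almost 2-perfect (A2P) if one can choose, for each $C\in\mathcal{C}$, an inside 8-cycle $C'$ of $C$ such that the chosen cycles $\mathcal{C}'=\{C'\}$ are pairwise edge-disjoint and contain no edge of $\mathcal{L}$, i.e. $(\mathcal{X},\mathcal{C}',\mathcal{L})$ is again an 8-cycle packing of $K_n$ with the same leave. *)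

theory Defs
  imports Main
begin

definition complete_edges :: "'a set \<Rightarrow> 'a set set" where
  "complete_edges X = {e. e \<subseteq> X \<and> card e = 2}"

definition is_8cycle :: "'a set set \<Rightarrow> bool" where
  "is_8cycle C \<longleftrightarrow> (\<exists>v :: nat \<Rightarrow> 'a. inj_on v {0..<8} \<and>
      C = {{v i, v ((i + 1) mod 8)} | i. i < 8})"

definition cycle_vertices :: "'a set set \<Rightarrow> 'a set" where
  "cycle_vertices C = \<Union>C"

definition is_8cycle_packing :: "'a set \<Rightarrow> 'a set set set \<Rightarrow> 'a set set \<Rightarrow> bool" where
  "is_8cycle_packing X CC L \<longleftrightarrow>
     (\<forall>C\<in>CC. is_8cycle C \<and> C \<subseteq> complete_edges X) \<and>
     (\<forall>C1\<in>CC. \<forall>C2\<in>CC. C1 \<noteq> C2 \<longrightarrow> C1 \<inter> C2 = {}) \<and>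
     L = complete_edges X - \<Union>CC"

definition is_max_8cycle_packing :: "'a set \<Rightarrow> 'a set set set \<Rightarrow> 'a set set \<Rightarrow> bool" where
  "is_max_8cycle_packing X CC L \<longleftrightarrow>
     is_8cycle_packing X CC L \<and>
     (\<forall>CC' L'. is_8cycle_packing X CC' L' \<longrightarrow> card L \<le> card L')"

definition is_inside_8cycle :: "'a set set \<Rightarrow> 'a set set \<Rightarrow> bool" where
  "is_inside_8cycle C C' \<longleftrightarrow> is_8cycle C' \<and> cycle_vertices C' = cycle_vertices C \<and> C' \<inter> C = {}"

definition is_A2P :: "'a set \<Rightarrow> 'a set set set \<Rightarrow> 'a set set \<Rightarrow> bool" where
  "is_A2P X CC L \<longleftrightarrow> is_8cycle_packing X CC L \<and>
     (\<exists>f. (\<forall>C\<in>CC. is_inside_8cycle C (f C)) \<and>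
          (\<forall>C1\<in>CC. \<forall>C2\<in>CC. C1 \<noteq> C2 \<longrightarrow> f C1 \<inter> f C2 = {}) \<and>
          (\<forall>C\<in>CC. f C \<inter> L = {}) \<and>
          is_8cycle_packing X (f ` CC) L)"

end

theory Submission
  imports Defs "HOL-Library.Multiset" "HOL-Library.Product_Lexorder"
begin

text \<open>
  Call a graph A2P-decomposable if it is the edge-disjoint union of 8-cycles that have inside
  8-cycles with the same union. Such graphs are closed under edge-disjoint union. The complement of
  an 8-cycle in \<open>K\<^sub>4\<^sub>,\<^sub>4\<close> is again an 8-cycle, which makes \<open>K\<^sub>4\<^sub>,\<^sub>4\<close> and \<open>K\<^sub>4\<^sub>,\<^sub>6\<close> decomposable, hence
  also every complete bipartite graph with parts of size \<open>4s\<close> and \<open>2t \<ge> 4\<close>.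

  For even \<open>n\<close>, adding 8 points with a packing of \<open>K\<^sub>8\<close> whose leave is a perfect matching enlarges the
  leave by 4 edges. For odd \<open>n\<close>, adding 16 points and using a decomposition of \<open>K\<^sub>1\<^sub>7\<close> on the new
  points and one old point leaves the leave unchanged. Explicit packings
  found by computer search start both recursions. The packings are maximum because the size of the leave is fixed modulo 8
  and its degrees have the parity of \<open>n - 1\<close>: for even \<open>n\<close> it has at least \<open>n / 2\<close> edges, for odd \<open>n\<close>
  it cannot have 1 or 2 edges.
\<close>

section \<open>Decompositions into cycles with inside cycles\<close>

text \<open>That \<open>CC\<close> and the inside cycles both have union \<open>G\<close> encodes
  the common leave. No ambient vertex set occurs, so decompositions of edge-disjoint graphs can be
  joined.\<close>

definition a2p_decomposable :: "'a set set \<Rightarrow> bool" where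
  "a2p_decomposable G \<longleftrightarrow>
     (\<exists>CC f. (\<forall>C\<in>CC. is_8cycle C \<and> is_inside_8cycle C (f C)) \<and>
        (\<forall>C1\<in>CC. \<forall>C2\<in>CC. C1 \<noteq> C2 \<longrightarrow> C1 \<inter> C2 = {} \<and> f C1 \<inter> f C2 = {}) \<and>
        \<Union>CC = G \<and> \<Union>(f ` CC) = G)"

lemma is_8cycle_nonempty: "is_8cycle C \<Longrightarrow> C \<noteq> {}"
  unfolding is_8cycle_def using zero_less_numeral by blast

lemma a2p_decomposable_empty: "a2p_decomposable {}"
  unfolding a2p_decomposable_def by (rule exI[of _ "{}"]) auto

text \<open>The two choices of inside cycles glue to one function: a cycle in both families would
  lie in \<open>G \<inter> H = {}\<close>, but cycles are nonempty.\<close>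

lemma a2p_decomposable_Un:
  assumes G: "a2p_decomposable G" and H: "a2p_decomposable H" and GH: "G \<inter> H = {}"
  shows "a2p_decomposable (G \<union> H)"
proof -
  obtain CC f where f: "\<And>C. C \<in> CC \<Longrightarrow> is_8cycle C \<and> is_inside_8cycle C (f C)"
    "\<And>C1 C2. C1 \<in> CC \<Longrightarrow> C2 \<in> CC \<Longrightarrow> C1 \<noteq> C2 \<Longrightarrow> C1 \<inter> C2 = {} \<and> f C1 \<inter> f C2 = {}"
    "\<Union>CC = G" "\<Union>(f ` CC) = G"
    using G unfolding a2p_decomposable_def by metis
  obtain DD g where g: "\<And>C. C \<in> DD \<Longrightarrow> is_8cycle C \<and> is_inside_8cycle C (g C)"
    "\<And>C1 C2. C1 \<in> DD \<Longrightarrow> C2 \<in> DD \<Longrightarrow> C1 \<noteq> C2 \<Longrightarrow> C1 \<inter> C2 = {} \<and> g C1 \<inter> g C2 = {}"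
    "\<Union>DD = H" "\<Union>(g ` DD) = H"
    using H unfolding a2p_decomposable_def by metis
  define h where "h C = (if C \<in> CC then f C else g C)" for C
  have notin: "C \<notin> CC" if "C \<in> DD" for C
  proof
    assume "C \<in> CC"
    then have "C \<subseteq> G \<inter> H" using that f(3) g(3) by blast
    then show False using GH is_8cycle_nonempty f(1)[OF \<open>C \<in> CC\<close>] by auto
  qed
  have hf: "h C = f C" if "C \<in> CC" for C using that by (simp add: h_def)
  have hg: "h C = g C" if "C \<in> DD" for C using notin[OF that] by (simp add: h_def)
  have cross: "C \<inter> D = {} \<and> h C \<inter> h D = {}" if "C \<in> CC" "D \<in> DD" for C D
  proof -
    have "C \<subseteq> G" "h C \<subseteq> G" using f(3,4) hf[OF that(1)] that(1) by auto
    moreover have "D \<subseteq> H" "h D \<subseteq> H" using g(3,4) hg[OF that(2)] that(2) by auto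
    ultimately show ?thesis using GH by blast
  qed
  have "\<forall>C\<in>CC \<union> DD. is_8cycle C \<and> is_inside_8cycle C (h C)"
    using f(1) g(1) hf hg by auto
  moreover have "\<forall>C1\<in>CC \<union> DD. \<forall>C2\<in>CC \<union> DD. C1 \<noteq> C2 \<longrightarrow>
      C1 \<inter> C2 = {} \<and> h C1 \<inter> h C2 = {}"
  proof (intro ballI impI)
    fix C1 C2 assume C: "C1 \<in> CC \<union> DD" "C2 \<in> CC \<union> DD" "C1 \<noteq> C2"
    then consider "C1 \<in> CC" "C2 \<in> CC" | "C1 \<in> DD" "C2 \<in> DD" | "C1 \<in> CC" "C2 \<in> DD"
      | "C1 \<in> DD" "C2 \<in> CC" by blast
    then show "C1 \<inter> C2 = {} \<and> h C1 \<inter> h C2 = {}"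
    proof cases
      case 1 then show ?thesis using f(2) C(3) hf by metis
    next
      case 2 then show ?thesis using g(2) C(3) hg by metis
    next
      case 3 then show ?thesis by (rule cross)
    next
      case 4 then show ?thesis using cross by blast
    qed
  qed
  moreover have "\<Union>(CC \<union> DD) = G \<union> H" using f(3) g(3) by auto
  moreover have "\<Union>(h ` (CC \<union> DD)) = G \<union> H"
  proof -
    have "h ` CC = f ` CC" "h ` DD = g ` DD" using hf hg by (auto simp: image_iff)
    then show ?thesis using f(4) g(4) by (simp add: image_Un)
  qed
  ultimately show ?thesis unfolding a2p_decomposable_def by blast
qed

lemma is_8cycle_image:
  assumes "is_8cycle C" "inj_on h (\<Union>C)"
  shows "is_8cycle ((`) h ` C)"
proof -
  obtain v :: "nat \<Rightarrow> 'a" where v: "inj_on v {0..<8}" "C = {{v i, v ((i + 1) mod 8)} | i. i < 8}"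
    using assms(1) unfolding is_8cycle_def by blast
  have "v i \<in> \<Union>C" if "i < 8" for i
    using that unfolding v(2) by (intro UnionI[of "{v i, v ((i + 1) mod 8)}"]) auto
  then have "v ` {0..<8} \<subseteq> \<Union>C" by auto
  then have "inj_on (h \<circ> v) {0..<8}"
    using v(1) assms(2) by (meson comp_inj_on inj_on_subset)
  moreover have "(`) h ` C = {{(h \<circ> v) i, (h \<circ> v) ((i + 1) mod 8)} | i. i < 8}"
    unfolding v(2) setcompr_eq_image image_image by simp
  ultimately show ?thesis unfolding is_8cycle_def by blast
qed

text \<open>Injectivity on the covered vertices makes the induced maps on edges and on sets of edges
  injective too, so disjointness is preserved and the choice of inside cycles can be
  transported.\<close>

lemma a2p_decomposable_image:
  assumes G: "a2p_decomposable G" and h: "inj_on h (\<Union>G)"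
  shows "a2p_decomposable ((`) h ` G)"
proof -
  obtain CC f where f: "\<And>C. C \<in> CC \<Longrightarrow> is_8cycle C \<and> is_inside_8cycle C (f C)"
    "\<And>C1 C2. C1 \<in> CC \<Longrightarrow> C2 \<in> CC \<Longrightarrow> C1 \<noteq> C2 \<Longrightarrow> C1 \<inter> C2 = {} \<and> f C1 \<inter> f C2 = {}"
    "\<Union>CC = G" "\<Union>(f ` CC) = G"
    using G unfolding a2p_decomposable_def by metis
  define H where "H = (\<lambda>C::'a set set. (`) h ` C)"
  have inj: "inj_on ((`) h) G" using h by (simp add: inj_on_image)
  have injH: "inj_on H (Pow G)" unfolding H_def using inj by (rule inj_on_image_Pow)
  have CG: "C \<subseteq> G" "f C \<subseteq> G" if "C \<in> CC" for C using that f(3,4) by auto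
  have Int: "H (A \<inter> B) = H A \<inter> H B" if "A \<subseteq> G" "B \<subseteq> G" for A B
    unfolding H_def using inj that by (simp add: inj_on_image_Int)
  \<comment> \<open>The choice function is conjugated by \<open>H\<close>: pull a cycle back, take
    its inside cycle, push that forward.\<close>
  define g where "g D = H (f (the_inv_into CC H D))" for D
  have gH: "g (H C) = H (f C)" if "C \<in> CC" for C
    unfolding g_def using that injH CG
    by (metis PowI inj_on_subset subsetI the_inv_into_f_f)
  have inside: "is_inside_8cycle (H C) (H (f C))" if "C \<in> CC" for C
  proof -
    have c: "is_8cycle (f C)" "\<Union>(f C) = \<Union>C" "f C \<inter> C = {}"
      using f(1)[OF that] unfolding is_inside_8cycle_def cycle_vertices_def by auto
    have "is_8cycle (H (f C))" unfolding H_def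
      using c(1) h CG(2)[OF that] by (intro is_8cycle_image) (auto intro: inj_on_subset)
    moreover have "\<Union>(H (f C)) = \<Union>(H C)"
      unfolding H_def using c(2) by (metis image_Union)
    moreover have "H (f C) \<inter> H C = {}"
      using Int[OF CG(2)[OF that] CG(1)[OF that]] c(3) by (simp add: H_def)
    ultimately show ?thesis unfolding is_inside_8cycle_def cycle_vertices_def by simp
  qed
  have cyc: "is_8cycle (H C)" if "C \<in> CC" for C unfolding H_def
    using f(1)[OF that] h CG(1)[OF that] by (intro is_8cycle_image) (auto intro: inj_on_subset)
  have "\<forall>D\<in>H ` CC. is_8cycle D \<and> is_inside_8cycle D (g D)"
    using cyc inside gH by auto
  moreover have "\<forall>D1\<in>H ` CC. \<forall>D2\<in>H ` CC. D1 \<noteq> D2 \<longrightarrow> D1 \<inter> D2 = {} \<and> g D1 \<inter> g D2 = {}"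
  proof (intro ballI impI)
    fix D1 D2 assume "D1 \<in> H ` CC" "D2 \<in> H ` CC" "D1 \<noteq> D2"
    then obtain C1 C2 where C: "C1 \<in> CC" "C2 \<in> CC" "C1 \<noteq> C2" "D1 = H C1" "D2 = H C2" by auto
    then have "D1 \<inter> D2 = H (C1 \<inter> C2)" "g D1 \<inter> g D2 = H (f C1 \<inter> f C2)"
      using Int CG gH by auto
    then show "D1 \<inter> D2 = {} \<and> g D1 \<inter> g D2 = {}"
      using f(2)[OF C(1-3)] by (simp add: H_def)
  qed
  moreover have "\<Union>(H ` CC) = (`) h ` G" unfolding H_def using f(3) by auto
  moreover have "\<Union>(g ` H ` CC) = (`) h ` G"
  proof -
    have "g ` H ` CC = H ` f ` CC" using gH by (auto simp: image_iff)
    then show ?thesis using f(4) unfolding H_def by auto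
  qed
  ultimately show ?thesis unfolding a2p_decomposable_def by blast
qed

section \<open>Certificates\<close>

text \<open>Edges are pairs with the smaller endpoint first, so that each undirected edge has one
  representation and edge lists can be sorted. \<open>rotate1\<close> supplies the closing
  edge.\<close>

definition cycle_edges :: "nat list \<Rightarrow> (nat \<times> nat) list" where
  "cycle_edges xs = map2 (\<lambda>x y. (min x y, max x y)) xs (rotate1 xs)"

definition doubleton :: "nat \<times> nat \<Rightarrow> nat set" where
  "doubleton e = {fst e, snd e}"

lemma inj_on_doubleton: "inj_on doubleton {e. fst e \<le> snd e}"
  by (auto simp: inj_on_def doubleton_def doubleton_eq_iff)

lemma cycle_edges_ordered: "set (cycle_edges xs) \<subseteq> {e. fst e \<le> snd e}"
  by (auto simp: cycle_edges_def)

lemma length_cycle_edges [simp]: "length (cycle_edges xs) = length xs"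
  by (simp add: cycle_edges_def)

lemma doubleton_cycle_edges:
  assumes "length xs = 8"
  shows "doubleton ` set (cycle_edges xs) = {{xs ! i, xs ! ((i + 1) mod 8)} | i. i < 8}"
proof -
  have "doubleton (cycle_edges xs ! i) = {xs ! i, xs ! ((i + 1) mod 8)}" if "i < 8" for i
    using that assms by (auto simp: doubleton_def cycle_edges_def nth_rotate1 min_def max_def)
  moreover have "doubleton ` set (cycle_edges xs) = {doubleton (cycle_edges xs ! i) | i. i < 8}"
    using assms by (auto simp: set_conv_nth)
  ultimately show ?thesis by auto
qed

lemma is_8cycle_cycle_edges:
  assumes "length xs = 8" "distinct xs"
  shows "is_8cycle (doubleton ` set (cycle_edges xs))"
  unfolding is_8cycle_def doubleton_cycle_edges[OF assms(1)]
  using assms by (intro exI[of _ "\<lambda>i. xs ! i"]) (auto simp: inj_on_def nth_eq_iff_index_eq)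

lemma Union_cycle_edges:
  assumes "length xs = 8"
  shows "\<Union>(doubleton ` set (cycle_edges xs)) = set xs"
proof
  show "\<Union>(doubleton ` set (cycle_edges xs)) \<subseteq> set xs"
    unfolding doubleton_cycle_edges[OF assms] using assms by auto
  show "set xs \<subseteq> \<Union>(doubleton ` set (cycle_edges xs))"
    unfolding doubleton_cycle_edges[OF assms] using assms by (auto simp: set_conv_nth)
qed

text \<open>
  A certificate lists cycles, each paired with its inside cycle. Comparing sorted edge lists keeps
  the check by \<open>code_simp\<close> fast; \<open>Multiset\<close> provides the quicksort code equation.
\<close>

definition certificate_edges :: "(nat list \<times> nat list) list \<Rightarrow> (nat \<times> nat) list" where
  "certificate_edges ps = concat (map (\<lambda>p. cycle_edges (fst p)) ps)"

definition inside_edges :: "(nat list \<times> nat list) list \<Rightarrow> (nat \<times> nat) list" where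
  "inside_edges ps = concat (map (\<lambda>p. cycle_edges (snd p)) ps)"

definition valid_certificate :: "(nat list \<times> nat list) list \<Rightarrow> bool" where
  "valid_certificate ps \<longleftrightarrow>
     (\<forall>(xs, ys)\<in>set ps. length xs = 8 \<and> length ys = 8 \<and> distinct xs \<and> distinct ys \<and>
       set ys \<subseteq> set xs \<and> (\<forall>e\<in>set (cycle_edges ys). e \<notin> set (cycle_edges xs))) \<and>
     successively (<) (sort (certificate_edges ps)) \<and>
     sort (inside_edges ps) = sort (certificate_edges ps)"

text \<open>A strictly increasing list has no repetition. Equal sorted lists come from equal
  multisets, so distinctness passes to the inside edges.\<close>

lemma valid_certificate_edges:
  assumes "valid_certificate ps"
  shows "distinct (certificate_edges ps)" "distinct (inside_edges ps)"
    "set (inside_edges ps) = set (certificate_edges ps)"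
proof -
  have *: "sorted_wrt (<) (sort (certificate_edges ps))"
    "sort (inside_edges ps) = sort (certificate_edges ps)"
    using assms unfolding valid_certificate_def by (auto simp: successively_conv_sorted_wrt)
  then show "distinct (certificate_edges ps)" "distinct (inside_edges ps)"
    by (metis distinct_sort strict_sorted_iff)+
  show "set (inside_edges ps) = set (certificate_edges ps)" using *(2) by (metis set_sort)
qed

lemma a2p_decomposable_certificate:
  assumes "valid_certificate ps"
  shows "a2p_decomposable (doubleton ` set (certificate_edges ps))"
proof -
  define E where "E xs = doubleton ` set (cycle_edges xs)" for xs
  have len: "length xs = 8" "length ys = 8" "distinct xs" "distinct ys" "set ys \<subseteq> set xs"
    "set (cycle_edges xs) \<inter> set (cycle_edges ys) = {}" if "(xs, ys) \<in> set ps" for xs ys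
    using assms that unfolding valid_certificate_def by auto
  \<comment> \<open>Both lists have 8 different entries, so inclusion forces equality.\<close>
  have seteq: "set ys = set xs" if "(xs, ys) \<in> set ps" for xs ys
    using len[OF that] by (metis List.finite_set card_subset_eq distinct_card)
  have EInt: "E xs \<inter> E ys = {}" if "set (cycle_edges xs) \<inter> set (cycle_edges ys) = {}" for xs ys
    unfolding E_def using that inj_on_image_Int[OF inj_on_doubleton cycle_edges_ordered cycle_edges_ordered]
    by (metis image_empty)
  note dis = valid_certificate_edges(1,2)[OF assms]
  note sets = valid_certificate_edges(3)[OF assms]
  have ne: "cycle_edges (fst p) \<noteq> []" "cycle_edges (snd p) \<noteq> []" if "p \<in> set ps" for p
    using len(1,2)[of "fst p" "snd p"] that
    by (metis length_cycle_edges list.size(3) prod.collapse zero_neq_numeral)+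
  have dj: "set (cycle_edges (g p)) \<inter> set (cycle_edges (g q)) = {}"
    if "distinct (concat (map (\<lambda>p. cycle_edges (g p)) qs))" "p \<in> set qs" "q \<in> set qs" "p \<noteq> q"
    for g :: "nat list \<times> nat list \<Rightarrow> nat list" and p q qs
    using that by (induction qs) auto
  have dj1: "E (fst p) \<inter> E (fst q) = {}" "E (snd p) \<inter> E (snd q) = {}"
    if "p \<in> set ps" "q \<in> set ps" "p \<noteq> q" for p q
    using EInt[OF dj[of fst ps, OF _ that]] EInt[OF dj[of snd ps, OF _ that]] dis
    unfolding certificate_edges_def inside_edges_def by simp_all
  have ne': "E (fst p) \<noteq> {}" if "p \<in> set ps" for p
    using ne[OF that] unfolding E_def by auto
  \<comment> \<open>Disjoint nonempty cycles are different, so a cycle determines its pair and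
    \<open>f\<close> below is well defined.\<close>
  have inj: "inj_on (\<lambda>p. E (fst p)) (set ps)"
    using dj1(1) ne' by (force simp: inj_on_def)
  define f where "f C = E (snd (the_inv_into (set ps) (\<lambda>p. E (fst p)) C))" for C
  have fE: "f (E (fst p)) = E (snd p)" if "p \<in> set ps" for p
    unfolding f_def using the_inv_into_f_f[OF inj that] by simp
  define CC where "CC = (\<lambda>p. E (fst p)) ` set ps"
  have "\<forall>C\<in>CC. is_8cycle C \<and> is_inside_8cycle C (f C)"
  proof
    fix C assume "C \<in> CC"
    then obtain xs ys where p: "(xs, ys) \<in> set ps" "C = E xs" unfolding CC_def by auto
    then show "is_8cycle C \<and> is_inside_8cycle C (f C)"
      using len[OF p(1)] fE[OF p(1)] seteq[OF p(1)] EInt[of ys xs]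
        is_8cycle_cycle_edges Union_cycle_edges
      unfolding is_inside_8cycle_def cycle_vertices_def
      by (auto simp: E_def Int_commute)
  qed
  moreover have "\<forall>C1\<in>CC. \<forall>C2\<in>CC. C1 \<noteq> C2 \<longrightarrow> C1 \<inter> C2 = {} \<and> f C1 \<inter> f C2 = {}"
  proof (intro ballI impI)
    fix C1 C2 assume "C1 \<in> CC" "C2 \<in> CC" "C1 \<noteq> C2"
    then obtain p q where "p \<in> set ps" "q \<in> set ps" "p \<noteq> q" "C1 = E (fst p)" "C2 = E (fst q)"
      unfolding CC_def by blast
    then show "C1 \<inter> C2 = {} \<and> f C1 \<inter> f C2 = {}" using dj1 fE by simp
  qed
  moreover have "\<Union>CC = doubleton ` set (certificate_edges ps)"
    unfolding CC_def E_def certificate_edges_def by auto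
  moreover have "\<Union>(f ` CC) = doubleton ` set (inside_edges ps)"
  proof -
    have "f ` CC = (\<lambda>p. E (snd p)) ` set ps" unfolding CC_def using fE by (auto simp: image_iff)
    then show ?thesis unfolding E_def inside_edges_def by auto
  qed
  ultimately show ?thesis unfolding a2p_decomposable_def sets by blast
qed

section \<open>Complete graphs and complete bipartite graphs\<close>

definition bipartite_edges :: "'a set \<Rightarrow> 'a set \<Rightarrow> 'a set set" where
  "bipartite_edges A B = {{a, b} | a b. a \<in> A \<and> b \<in> B}"

text \<open>Only the size \<open>l\<close> of the leave is recorded: the recursions and the
  maximality argument use nothing else about it.\<close>

definition a2p_packable :: "'a set \<Rightarrow> nat \<Rightarrow> bool" where
  "a2p_packable X l \<longleftrightarrow>
     (\<exists>G \<subseteq> complete_edges X. a2p_decomposable G \<and> card (complete_edges X - G) = l)"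

lemma complete_edges_mono: "X \<subseteq> Y \<Longrightarrow> complete_edges X \<subseteq> complete_edges Y"
  unfolding complete_edges_def by auto

lemma finite_complete_edges: "finite X \<Longrightarrow> finite (complete_edges X)"
  unfolding complete_edges_def by (rule finite_subset[of _ "Pow X"]) auto

lemma card_complete_edges: "finite X \<Longrightarrow> card (complete_edges X) = card X choose 2"
  unfolding complete_edges_def by (rule n_subsets)

lemma complete_edges_image:
  assumes "inj_on h X"
  shows "complete_edges (h ` X) = (`) h ` complete_edges X"
proof
  show "(`) h ` complete_edges X \<subseteq> complete_edges (h ` X)"
    using assms unfolding complete_edges_def by (auto simp: card_image inj_on_subset)
  show "complete_edges (h ` X) \<subseteq> (`) h ` complete_edges X"
  proof
    fix e assume e: "e \<in> complete_edges (h ` X)"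
    then obtain d where d: "d \<subseteq> X" "e = h ` d"
      unfolding complete_edges_def by (auto simp: subset_image_iff)
    then have "card d = 2"
      using e assms unfolding complete_edges_def by (simp add: card_image inj_on_subset)
    then show "e \<in> (`) h ` complete_edges X" using d unfolding complete_edges_def by auto
  qed
qed

text \<open>Allows a packing found on an initial segment of the naturals to be placed on any finite
  set of the same size.\<close>

lemma a2p_packable_cong_card:
  assumes "a2p_packable X l" "finite X" "finite Y" "card X = card Y"
  shows "a2p_packable Y l"
proof -
  obtain h where "bij_betw h X Y" using assms finite_same_card_bij by blast
  then have h: "inj_on h X" "h ` X = Y" by (auto simp: bij_betw_def)
  obtain G where G: "G \<subseteq> complete_edges X" "a2p_decomposable G" "card (complete_edges X - G) = l"
    using assms(1) unfolding a2p_packable_def by blast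
  have sub: "\<Union>(complete_edges X) \<subseteq> X" unfolding complete_edges_def by auto
  have inj: "inj_on ((`) h) (complete_edges X)"
    using h(1) sub by (metis inj_on_image inj_on_subset)
  have "\<Union>G \<subseteq> X" using G(1) sub by blast
  then have "a2p_decomposable ((`) h ` G)"
    using a2p_decomposable_image[OF G(2)] h(1) inj_on_subset by blast
  moreover have "(`) h ` G \<subseteq> complete_edges Y"
    using G(1) h complete_edges_image by blast
  moreover have "complete_edges Y - (`) h ` G = (`) h ` (complete_edges X - G)"
    using inj_on_image_set_diff[OF inj _ G(1)] complete_edges_image[OF h(1)] h(2)
    by (metis Diff_subset order_refl)
  moreover have "card \<dots> = l"
    using inj G(3) by (metis Diff_subset card_image inj_on_subset)
  ultimately show ?thesis unfolding a2p_packable_def by metis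
qed

lemma doubleton_in_complete_edges: "{a, b} \<in> complete_edges X \<longleftrightarrow> a \<in> X \<and> b \<in> X \<and> a \<noteq> b"
  unfolding complete_edges_def by (auto simp: card_insert_if)

lemma in_complete_edgesE:
  assumes "e \<in> complete_edges X"
  obtains a b where "e = {a, b}" "a \<in> X" "b \<in> X" "a \<noteq> b"
  using assms unfolding complete_edges_def by (auto simp: card_2_iff)

text \<open>Edges of the union lie within \<open>X\<close>, within \<open>Y\<close>, or cross
  between the two differences. With at most one common point no edge lies within both, and all
  crossing edges are used, so the leaves add up.\<close>

lemma a2p_packable_Un:
  assumes X: "a2p_packable X l" "finite X" and Y: "a2p_packable Y m" "finite Y"
    and p: "X \<inter> Y \<subseteq> {p}" and B: "a2p_decomposable (bipartite_edges (X - Y) (Y - X))"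
  shows "a2p_packable (X \<union> Y) (l + m)"
proof -
  obtain G where G: "G \<subseteq> complete_edges X" "a2p_decomposable G" "card (complete_edges X - G) = l"
    using X(1) unfolding a2p_packable_def by blast
  obtain H where H: "H \<subseteq> complete_edges Y" "a2p_decomposable H" "card (complete_edges Y - H) = m"
    using Y(1) unfolding a2p_packable_def by blast
  let ?B = "bipartite_edges (X - Y) (Y - X)"
  have un: "complete_edges (X \<union> Y) = complete_edges X \<union> complete_edges Y \<union> ?B"
  proof
    show "complete_edges X \<union> complete_edges Y \<union> ?B \<subseteq> complete_edges (X \<union> Y)"
      using complete_edges_mono[of X "X \<union> Y"] complete_edges_mono[of Y "X \<union> Y"]
      unfolding bipartite_edges_def by (auto simp: doubleton_in_complete_edges)
    show "complete_edges (X \<union> Y) \<subseteq> complete_edges X \<union> complete_edges Y \<union> ?B"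
    proof
      fix e assume "e \<in> complete_edges (X \<union> Y)"
      then obtain a b where "e = {a, b}" "a \<in> X \<union> Y" "b \<in> X \<union> Y" "a \<noteq> b"
        by (rule in_complete_edgesE)
      then show "e \<in> complete_edges X \<union> complete_edges Y \<union> ?B"
        unfolding bipartite_edges_def by (auto simp: doubleton_in_complete_edges; blast)
    qed
  qed
  have XY: "complete_edges X \<inter> complete_edges Y = {}"
  proof (rule equals0I)
    fix e assume e: "e \<in> complete_edges X \<inter> complete_edges Y"
    then obtain a b where ab: "e = {a, b}" "a \<in> X" "b \<in> X" "a \<noteq> b"
      by (blast elim: in_complete_edgesE)
    then have "a \<in> Y" "b \<in> Y" using e by (simp_all add: doubleton_in_complete_edges)
    then show False using ab p by blast
  qed
  have XYB: "(complete_edges X \<union> complete_edges Y) \<inter> ?B = {}"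
    unfolding bipartite_edges_def by (auto simp: doubleton_in_complete_edges)
  have "a2p_decomposable (G \<union> H \<union> ?B)"
    using G H XY XYB B by (intro a2p_decomposable_Un) auto
  moreover have "G \<union> H \<union> ?B \<subseteq> complete_edges (X \<union> Y)" unfolding un using G H by auto
  moreover have "complete_edges (X \<union> Y) - (G \<union> H \<union> ?B) = (complete_edges X - G) \<union> (complete_edges Y - H)"
    unfolding un using G(1) H(1) XY XYB by blast
  moreover have "card \<dots> = l + m"
    using G(3) H(3) XY finite_complete_edges X(2) Y(2) by (subst card_Un_disjoint) auto
  ultimately show ?thesis unfolding a2p_packable_def by metis
qed

text \<open>The listed edges are distinct, 8 per cycle, so counting against
  \<open>n choose 2\<close> gives the size of the leave.\<close>

lemma a2p_packable_certificate:
  assumes "valid_certificate ps" "\<forall>e\<in>set (certificate_edges ps). fst e \<noteq> snd e \<and> snd e < n"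
    "8 * length ps + l = n choose 2"
  shows "a2p_packable {..<n} l"
proof -
  let ?G = "doubleton ` set (certificate_edges ps)"
  have ord: "set (certificate_edges ps) \<subseteq> {e. fst e \<le> snd e}"
    unfolding certificate_edges_def using cycle_edges_ordered by auto
  have sub: "?G \<subseteq> complete_edges {..<n}"
  proof
    fix d assume "d \<in> ?G"
    then obtain e where e: "e \<in> set (certificate_edges ps)" "d = {fst e, snd e}"
      unfolding doubleton_def by auto
    moreover have "fst e \<noteq> snd e" "snd e < n" "fst e \<le> snd e"
      using e(1) ord assms(2) by auto
    ultimately show "d \<in> complete_edges {..<n}" by (simp add: doubleton_in_complete_edges)
  qed
  have len: "\<forall>p\<in>set ps. length (fst p) = 8"
    using assms(1) unfolding valid_certificate_def by auto
  then have "length (certificate_edges ps) = 8 * length ps"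
    unfolding certificate_edges_def by (induction ps) auto
  moreover have "distinct (certificate_edges ps)"
    using assms(1) by (rule valid_certificate_edges)
  moreover have "inj_on doubleton (set (certificate_edges ps))"
    using inj_on_doubleton ord by (rule inj_on_subset)
  ultimately have "card ?G = 8 * length ps" by (simp add: card_image distinct_card)
  then have "card (complete_edges {..<n} - ?G) = l"
    using sub assms(3) by (simp add: card_Diff_subset card_complete_edges)
  then show ?thesis
    unfolding a2p_packable_def using sub a2p_decomposable_certificate[OF assms(1)] by blast
qed

lemma doubleton_image_Times: "doubleton ` (A \<times> B) = bipartite_edges A B"
proof -
  have "doubleton ` (A \<times> B) = {doubleton (a, b) | a b. a \<in> A \<and> b \<in> B}" by blast
  then show ?thesis by (simp add: doubleton_def bipartite_edges_def)
qed

lemma bipartite_edges_commute: "bipartite_edges A B = bipartite_edges B A"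
proof -
  have "bipartite_edges A B \<subseteq> bipartite_edges B A" for A B :: "'a set"
    unfolding bipartite_edges_def by (auto simp: doubleton_eq_iff)
  then show ?thesis by blast
qed

lemma bipartite_edges_image: "(`) h ` bipartite_edges A B = bipartite_edges (h ` A) (h ` B)"
proof
  show "(`) h ` bipartite_edges A B \<subseteq> bipartite_edges (h ` A) (h ` B)"
    unfolding bipartite_edges_def by auto
  show "bipartite_edges (h ` A) (h ` B) \<subseteq> (`) h ` bipartite_edges A B"
  proof
    fix e assume "e \<in> bipartite_edges (h ` A) (h ` B)"
    then obtain a b where "a \<in> A" "b \<in> B" "e = h ` {a, b}"
      unfolding bipartite_edges_def by auto
    then show "e \<in> (`) h ` bipartite_edges A B" unfolding bipartite_edges_def by blast
  qed
qed

lemma a2p_decomposable_bipartite_Un: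
  assumes "a2p_decomposable (bipartite_edges A B)" "a2p_decomposable (bipartite_edges A C)"
    "B \<inter> C = {}" "A \<inter> (B \<union> C) = {}"
  shows "a2p_decomposable (bipartite_edges A (B \<union> C))"
proof -
  have "bipartite_edges A (B \<union> C) = bipartite_edges A B \<union> bipartite_edges A C"
    unfolding bipartite_edges_def by auto
  moreover have "bipartite_edges A B \<inter> bipartite_edges A C = {}"
    using assms(3,4) unfolding bipartite_edges_def by (auto simp: doubleton_eq_iff)
  ultimately show ?thesis using assms(1,2) by (simp add: a2p_decomposable_Un)
qed

text \<open>Bijections between corresponding parts combine to one bijection of the vertices because
  the parts are disjoint on both sides.\<close>

lemma a2p_decomposable_bipartite_cong_card:
  assumes dec: "a2p_decomposable (bipartite_edges A B)" and AB: "A \<inter> B = {}" and A'B': "A' \<inter> B' = {}"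
    and fin: "finite A" "finite B" "finite A'" "finite B'"
    and card: "card A = card A'" "card B = card B'"
  shows "a2p_decomposable (bipartite_edges A' B')"
proof -
  obtain f where f: "bij_betw f A A'" using fin card finite_same_card_bij by blast
  obtain g where g: "bij_betw g B B'" using fin card finite_same_card_bij by blast
  define h where "h x = (if x \<in> A then f x else g x)" for x
  have hA: "h x = f x" if "x \<in> A" for x using that by (simp add: h_def)
  have hB: "h x = g x" if "x \<in> B" for x using that AB by (auto simp: h_def)
  have "bij_betw h A A'" using f hA by (simp cong: bij_betw_cong)
  moreover have "bij_betw h B B'" using g hB by (simp cong: bij_betw_cong)
  ultimately have h: "bij_betw h (A \<union> B) (A' \<union> B')" "h ` A = A'" "h ` B = B'"
    using bij_betw_combine[OF _ _ A'B'] by (auto simp: bij_betw_imp_surj_on)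
  have "\<Union>(bipartite_edges A B) \<subseteq> A \<union> B" unfolding bipartite_edges_def by auto
  then have "inj_on h (\<Union>(bipartite_edges A B))"
    using h(1) by (meson bij_betw_def inj_on_subset)
  then have "a2p_decomposable ((`) h ` bipartite_edges A B)"
    using dec by (rule a2p_decomposable_image[rotated])
  moreover have "(`) h ` bipartite_edges A B = bipartite_edges A' B'"
    unfolding h(2,3)[symmetric] by (rule bipartite_edges_image)
  ultimately show ?thesis by simp
qed

section \<open>Explicit packings of small complete graphs\<close>

text \<open>Three Hamiltonian cycles take 6 from the degree 7 of each vertex, so the leave is a
  perfect matching.\<close>

lemma a2p_packable_8: "a2p_packable {..<8::nat} 4"
proof (rule a2p_packable_certificate[where ps = "[
      ([5, 1, 7, 4, 2, 0, 6, 3], [5, 0, 7, 2, 1, 3, 4, 6]),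
      ([7, 5, 6, 2, 1, 4, 3, 0], [7, 4, 0, 2, 5, 1, 6, 3]),
      ([3, 7, 2, 5, 0, 4, 6, 1], [3, 5, 7, 1, 4, 2, 6, 0])]"])
qed (code_simp, code_simp, simp add: choose_two)

lemma a2p_packable_9: "a2p_packable {..<9::nat} 4"
proof (rule a2p_packable_certificate[where ps = "[
      ([7, 1, 3, 8, 5, 6, 2, 4], [7, 3, 6, 8, 4, 1, 5, 2]),
      ([3, 6, 0, 8, 7, 2, 5, 4], [3, 8, 2, 0, 4, 6, 7, 5]),
      ([8, 2, 0, 5, 7, 6, 1, 4], [8, 5, 4, 2, 6, 0, 7, 1]),
      ([8, 6, 4, 0, 7, 3, 5, 1], [8, 0, 5, 6, 1, 3, 4, 7])]"])
qed (code_simp, code_simp, simp add: choose_two)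

lemma a2p_packable_10: "a2p_packable {..<10::nat} 5"
proof (rule a2p_packable_certificate[where ps = "[
      ([9, 0, 4, 6, 2, 7, 1, 3], [9, 6, 3, 4, 7, 0, 2, 1]),
      ([2, 4, 9, 1, 6, 8, 5, 0], [2, 9, 5, 1, 4, 8, 0, 6]),
      ([0, 8, 4, 3, 5, 2, 9, 7], [0, 3, 7, 5, 8, 2, 4, 9]),
      ([5, 6, 0, 3, 8, 1, 4, 7], [5, 0, 4, 6, 8, 7, 1, 3]),
      ([6, 3, 7, 8, 2, 1, 5, 9], [6, 1, 8, 3, 9, 7, 2, 5])]"])
qed (code_simp, code_simp, simp add: choose_two)

lemma a2p_packable_11: "a2p_packable {..<11::nat} 7"
proof (rule a2p_packable_certificate[where ps = "[
      ([5, 7, 6, 4, 8, 9, 0, 2], [5, 8, 6, 2, 7, 9, 4, 0]),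
      ([6, 10, 3, 8, 7, 9, 4, 1], [6, 3, 7, 10, 4, 8, 1, 9]),
      ([10, 7, 3, 5, 9, 1, 8, 2], [10, 5, 2, 9, 3, 1, 7, 8]),
      ([10, 0, 5, 8, 6, 9, 3, 1], [10, 6, 1, 5, 3, 0, 8, 9]),
      ([2, 4, 0, 7, 1, 5, 10, 9], [2, 0, 9, 5, 7, 4, 1, 10]),
      ([8, 0, 3, 6, 2, 7, 4, 10], [8, 3, 10, 0, 7, 6, 4, 2])]"])
qed (code_simp, code_simp, simp add: choose_two)

text \<open>The leave size is congruent to 66, hence to 2, modulo 8 and is at least 12 / 2 = 6,
  which makes 10 the least possible value.\<close>

lemma a2p_packable_12: "a2p_packable {..<12::nat} 10"
proof (rule a2p_packable_certificate[where ps = "[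
      ([10, 3, 11, 8, 4, 1, 5, 9], [10, 8, 5, 3, 4, 9, 11, 1]),
      ([9, 6, 8, 2, 10, 7, 11, 0], [9, 2, 11, 6, 10, 0, 8, 7]),
      ([2, 9, 1, 10, 0, 5, 3, 4], [2, 10, 3, 9, 0, 4, 1, 5]),
      ([7, 8, 10, 4, 6, 5, 11, 9], [7, 4, 11, 8, 6, 9, 10, 5]),
      ([7, 3, 8, 0, 6, 2, 11, 1], [7, 0, 11, 3, 6, 1, 8, 2]),
      ([6, 11, 4, 0, 7, 2, 5, 10], [6, 0, 5, 11, 7, 10, 4, 2]),
      ([8, 1, 6, 3, 9, 4, 7, 5], [8, 3, 7, 1, 9, 5, 6, 4])]"])
qed (code_simp, code_simp, simp add: choose_two)

text \<open>The cycles and their inside cycles come in triples permuted by (0 1 2)(3 4 5)(6 7 8)(9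
  10 11), which fixes 12.\<close>

lemma a2p_packable_13: "a2p_packable {..<13::nat} 6"
proof (rule a2p_packable_certificate[where ps = "[
      ([2, 5, 9, 8, 4, 10, 11, 6], [2, 9, 6, 8, 10, 5, 11, 4]),
      ([0, 3, 10, 6, 5, 11, 9, 7], [0, 10, 7, 6, 11, 3, 9, 5]),
      ([1, 4, 11, 7, 3, 9, 10, 8], [1, 11, 8, 7, 9, 4, 10, 3]),
      ([4, 12, 11, 2, 8, 0, 5, 7], [4, 8, 5, 2, 12, 7, 11, 0]),
      ([5, 12, 9, 0, 6, 1, 3, 8], [5, 6, 3, 0, 12, 8, 9, 1]),
      ([3, 12, 10, 1, 7, 2, 4, 6], [3, 7, 4, 1, 12, 6, 10, 2]),
      ([8, 12, 1, 11, 3, 2, 10, 7], [8, 1, 7, 2, 11, 10, 12, 3]),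
      ([6, 12, 2, 9, 4, 0, 11, 8], [6, 2, 8, 0, 9, 11, 12, 4]),
      ([7, 12, 0, 10, 5, 1, 9, 6], [7, 0, 6, 1, 10, 9, 12, 5])]"])
qed (code_simp, code_simp, simp add: choose_two)

text \<open>Here 91 is congruent to 3 modulo 8, which is below 14 / 2 = 7, so 11 is the least
  possible leave size.\<close>

lemma a2p_packable_14: "a2p_packable {..<14::nat} 11"
proof (rule a2p_packable_certificate[where ps = "[
      ([4, 12, 9, 2, 11, 7, 1, 10], [4, 7, 12, 2, 10, 9, 11, 1]),
      ([11, 0, 5, 8, 10, 12, 3, 4], [11, 5, 12, 4, 8, 0, 10, 3]),
      ([7, 12, 0, 6, 5, 3, 8, 13], [7, 0, 5, 8, 12, 6, 13, 3]),
      ([0, 7, 5, 2, 6, 3, 13, 4], [0, 6, 5, 3, 4, 2, 7, 13]),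
      ([13, 2, 12, 8, 1, 6, 10, 5], [13, 8, 6, 2, 5, 1, 12, 10]),
      ([4, 8, 2, 10, 13, 11, 6, 9], [4, 13, 9, 2, 11, 8, 10, 6]),
      ([8, 7, 2, 4, 1, 13, 9, 11], [8, 2, 13, 11, 4, 9, 7, 1]),
      ([9, 0, 13, 6, 12, 11, 5, 1], [9, 12, 0, 11, 6, 1, 13, 5]),
      ([3, 9, 10, 0, 8, 6, 4, 7], [3, 8, 7, 10, 4, 0, 9, 6]),
      ([3, 10, 7, 9, 5, 12, 1, 11], [3, 9, 1, 10, 5, 7, 11, 12])]"])
qed (code_simp, code_simp, simp add: choose_two)

text \<open>Since 105 is congruent to 1 modulo 8 and a graph with even degrees cannot have a single
  edge, 9 is least possible. The cycles form triples under (0 1 2)(3 4 5)(6 7 8)(9 10 11)(12 13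
  14).\<close>

lemma a2p_packable_15: "a2p_packable {..<15::nat} 9"
proof (rule a2p_packable_certificate[where ps = "[
      ([5, 11, 1, 12, 10, 2, 8, 14], [5, 1, 14, 12, 8, 10, 11, 2]),
      ([3, 9, 2, 13, 11, 0, 6, 12], [3, 2, 12, 13, 6, 11, 9, 0]),
      ([4, 10, 0, 14, 9, 1, 7, 13], [4, 0, 13, 14, 7, 9, 10, 1]),
      ([6, 13, 8, 1, 4, 2, 7, 3], [6, 1, 3, 8, 4, 7, 13, 2]),
      ([7, 14, 6, 2, 5, 0, 8, 4], [7, 2, 4, 6, 5, 8, 14, 0]),
      ([8, 12, 7, 0, 3, 1, 6, 5], [8, 0, 5, 7, 3, 6, 12, 1]),
      ([3, 14, 1, 13, 9, 8, 11, 2], [3, 13, 8, 2, 14, 11, 1, 9]),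
      ([4, 12, 2, 14, 10, 6, 9, 0], [4, 14, 6, 0, 12, 9, 2, 10]),
      ([5, 13, 0, 12, 11, 7, 10, 1], [5, 12, 7, 1, 13, 10, 0, 11]),
      ([8, 3, 13, 12, 9, 4, 11, 10], [8, 9, 13, 4, 12, 10, 3, 11]),
      ([6, 4, 14, 13, 10, 5, 9, 11], [6, 10, 14, 5, 13, 11, 4, 9]),
      ([7, 5, 12, 14, 11, 3, 10, 9], [7, 11, 12, 3, 14, 9, 5, 10])]"])
qed (code_simp, code_simp, simp add: choose_two)

text \<open>Going once around the base cycle, or around its inside cycle, each difference
  \<plusminus>1, ..., \<plusminus>8 modulo 17 occurs exactly once. Hence the 17 translates cover
  every edge exactly once.\<close>

lemma a2p_packable_17: "a2p_packable {..<17::nat} 0"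
proof (rule a2p_packable_certificate[where ps =
      "map (\<lambda>i. (map (\<lambda>x. (x + i) mod 17) [3, 16, 4, 13, 7, 8, 15, 1],
        map (\<lambda>x. (x + i) mod 17) [3, 13, 15, 16, 7, 1, 4, 8])) [0..<17]"])
qed (code_simp, code_simp, simp add: choose_two)

text \<open>The cycles form triples under the permutation (0 1 2)(3 4 5)...(15 16 17), which fixes
  18.\<close>

lemma a2p_packable_19: "a2p_packable {..<19::nat} 3"
proof (rule a2p_packable_certificate[where ps = "[
      ([13, 11, 5, 1, 10, 14, 17, 0], [13, 5, 17, 10, 11, 0, 14, 1]),
      ([14, 9, 3, 2, 11, 12, 15, 1], [14, 3, 15, 11, 9, 1, 12, 2]),
      ([12, 10, 4, 0, 9, 13, 16, 2], [12, 4, 16, 9, 10, 2, 13, 0]),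
      ([5, 3, 12, 1, 4, 2, 17, 16], [5, 12, 16, 1, 17, 4, 3, 2]),
      ([3, 4, 13, 2, 5, 0, 15, 17], [3, 13, 17, 2, 15, 5, 4, 0]),
      ([4, 5, 14, 0, 3, 1, 16, 15], [4, 14, 15, 0, 16, 3, 5, 1]),
      ([13, 7, 18, 9, 4, 8, 0, 12], [13, 18, 4, 7, 0, 9, 12, 8]),
      ([14, 8, 18, 10, 5, 6, 1, 13], [14, 18, 5, 8, 1, 10, 13, 6]),
      ([12, 6, 18, 11, 3, 7, 2, 14], [12, 18, 3, 6, 2, 11, 14, 7]),
      ([10, 13, 8, 17, 4, 16, 14, 3], [10, 4, 13, 14, 8, 3, 17, 16]),
      ([11, 14, 6, 15, 5, 17, 12, 4], [11, 5, 14, 12, 6, 4, 15, 17]),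
      ([9, 12, 7, 16, 3, 15, 13, 5], [9, 3, 12, 13, 7, 5, 16, 15]),
      ([1, 18, 3, 13, 6, 16, 11, 7], [1, 3, 7, 6, 18, 16, 13, 11]),
      ([2, 18, 4, 14, 7, 17, 9, 8], [2, 4, 8, 7, 18, 17, 14, 9]),
      ([0, 18, 5, 12, 8, 15, 10, 6], [0, 5, 6, 8, 18, 15, 12, 10]),
      ([15, 9, 7, 0, 10, 17, 13, 18], [15, 7, 10, 18, 0, 17, 9, 13]),
      ([16, 10, 8, 1, 11, 15, 14, 18], [16, 8, 11, 18, 1, 15, 10, 14]),
      ([17, 11, 6, 2, 9, 16, 12, 18], [17, 6, 9, 18, 2, 16, 11, 12]),
      ([8, 11, 9, 1, 17, 6, 4, 7], [8, 9, 4, 11, 6, 1, 7, 17]),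
      ([6, 9, 10, 2, 15, 7, 5, 8], [6, 10, 5, 9, 7, 2, 8, 15]),
      ([7, 10, 11, 0, 16, 8, 3, 6], [7, 11, 3, 10, 8, 0, 6, 16])]"])
qed (code_simp, code_simp, simp add: choose_two)

text \<open>The last 12 cycles decompose copies of \<open>K\<^sub>4\<^sub>,\<^sub>4\<close> and \<open>K\<^sub>4\<^sub>,\<^sub>6\<close>.\<close>

lemma a2p_packable_23: "a2p_packable {..<23::nat} 5"
proof (rule a2p_packable_certificate[where ps = "[
      ([6, 3, 17, 15, 1, 16, 20, 21], [6, 15, 21, 1, 17, 20, 3, 16]),
      ([19, 6, 5, 22, 4, 2, 17, 1], [19, 5, 2, 22, 1, 6, 4, 17]),
      ([15, 14, 7, 11, 0, 16, 13, 12], [15, 11, 16, 14, 12, 7, 0, 13]),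
      ([5, 18, 15, 13, 17, 22, 16, 4], [5, 17, 15, 4, 22, 18, 13, 16]),
      ([21, 2, 6, 17, 20, 0, 22, 3], [21, 17, 3, 0, 2, 20, 6, 22]),
      ([15, 19, 22, 20, 5, 0, 3, 16], [15, 20, 0, 19, 16, 22, 5, 3]),
      ([8, 14, 9, 0, 13, 18, 12, 7], [8, 0, 18, 14, 13, 7, 9, 12]),
      ([2, 16, 6, 15, 4, 20, 18, 22], [2, 6, 18, 4, 16, 20, 22, 15]),
      ([21, 4, 18, 1, 3, 20, 2, 19], [21, 3, 18, 19, 20, 1, 4, 2]),
      ([2, 5, 19, 20, 6, 18, 21, 0], [2, 19, 6, 0, 5, 21, 20, 18]),
      ([9, 13, 14, 0, 7, 10, 11, 8], [9, 14, 7, 8, 13, 10, 0, 11]),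
      ([5, 15, 20, 1, 4, 19, 16, 21], [5, 20, 4, 21, 19, 15, 16, 1]),
      ([12, 0, 10, 14, 17, 18, 11, 16], [12, 10, 11, 14, 0, 17, 16, 18]),
      ([14, 16, 17, 21, 22, 15, 0, 18], [14, 17, 22, 0, 16, 21, 18, 15]),
      ([0, 8, 13, 10, 12, 9, 11, 17], [0, 12, 17, 13, 11, 8, 10, 9]),
      ([4, 17, 19, 18, 3, 5, 1, 6], [4, 19, 3, 1, 18, 17, 6, 5]),
      ([3, 15, 21, 1, 22, 6, 0, 19], [3, 22, 19, 1, 15, 0, 21, 6]),
      ([5, 16, 18, 2, 15, 11, 12, 17], [5, 18, 11, 17, 2, 16, 12, 15]),
      ([10, 9, 7, 13, 11, 14, 12, 8], [10, 7, 11, 12, 13, 9, 8, 14]),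
      ([7, 15, 8, 16, 9, 17, 10, 18], [7, 17, 8, 18, 9, 15, 10, 16]),
      ([7, 17, 8, 18, 9, 15, 10, 16], [7, 15, 8, 16, 9, 17, 10, 18]),
      ([7, 19, 8, 20, 9, 21, 10, 22], [7, 21, 8, 22, 9, 19, 10, 20]),
      ([7, 21, 8, 22, 9, 19, 10, 20], [7, 19, 8, 20, 9, 21, 10, 22]),
      ([11, 19, 12, 20, 13, 21, 14, 22], [11, 21, 12, 22, 13, 19, 14, 20]),
      ([11, 21, 12, 22, 13, 19, 14, 20], [11, 19, 12, 20, 13, 21, 14, 22]),
      ([7, 1, 8, 2, 9, 3, 10, 4], [7, 3, 8, 4, 9, 1, 10, 2]),
      ([7, 3, 8, 4, 9, 5, 10, 6], [7, 5, 8, 6, 9, 3, 10, 4]),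
      ([7, 5, 8, 6, 9, 1, 10, 2], [7, 1, 8, 2, 9, 5, 10, 6]),
      ([11, 1, 12, 2, 13, 3, 14, 4], [11, 3, 12, 4, 13, 1, 14, 2]),
      ([11, 3, 12, 4, 13, 5, 14, 6], [11, 5, 12, 6, 13, 3, 14, 4]),
      ([11, 5, 12, 6, 13, 1, 14, 2], [11, 1, 12, 2, 13, 5, 14, 6])]"])
qed (code_simp, code_simp, simp add: choose_two)

section \<open>Decompositions of complete bipartite graphs\<close>

text \<open>The two cycles are complementary in the graph, and each serves as the inside cycle of
  the other.\<close>

lemma a2p_decomposable_bipartite_4_4: "a2p_decomposable (bipartite_edges {..<4} {4..<8::nat})"
proof -
  define ps :: "(nat list \<times> nat list) list" where "ps = [
      ([0, 4, 1, 5, 2, 6, 3, 7], [0, 6, 1, 7, 2, 4, 3, 5]),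
      ([0, 6, 1, 7, 2, 4, 3, 5], [0, 4, 1, 5, 2, 6, 3, 7])]"
  have "valid_certificate ps" unfolding ps_def by code_simp
  moreover have "doubleton ` set (certificate_edges ps) = bipartite_edges {..<4} {4..<8}"
  proof -
    have "set (certificate_edges ps) = {..<4} \<times> {4..<8}" unfolding ps_def by code_simp
    then show ?thesis by (simp add: doubleton_image_Times)
  qed
  ultimately show ?thesis using a2p_decomposable_certificate by metis
qed

text \<open>The six points form the pairs {4,5}, {6,7}, {8,9}. Each cycle uses two pairs, its inside
  cycle is its complement in the K_{4,4} on them, and the two cycles through a pair share out the 8
  edges at that pair.\<close>

lemma a2p_decomposable_bipartite_4_6: "a2p_decomposable (bipartite_edges {..<4} {4..<10::nat})"
proof -
  define ps :: "(nat list \<times> nat list) list" where "ps = [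
      ([0, 4, 1, 5, 2, 6, 3, 7], [0, 6, 1, 7, 2, 4, 3, 5]),
      ([0, 6, 1, 7, 2, 8, 3, 9], [0, 8, 1, 9, 2, 6, 3, 7]),
      ([0, 8, 1, 9, 2, 4, 3, 5], [0, 4, 1, 5, 2, 8, 3, 9])]"
  have "valid_certificate ps" unfolding ps_def by code_simp
  moreover have "doubleton ` set (certificate_edges ps) = bipartite_edges {..<4} {4..<10}"
  proof -
    have "set (certificate_edges ps) = {..<4} \<times> {4..<10}" unfolding ps_def by code_simp
    then show ?thesis by (simp add: doubleton_image_Times)
  qed
  ultimately show ?thesis using a2p_decomposable_certificate by metis
qed

text \<open>Repeatedly splitting 4 points off \<open>B\<close> ends at a part of size 4 or
  6.\<close>

lemma a2p_decomposable_bipartite_4: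
  assumes "finite A" "finite B" "A \<inter> B = {}" "card A = 4" "even (card B)" "4 \<le> card B"
  shows "a2p_decomposable (bipartite_edges A B)"
  using assms
proof (induction "card B" arbitrary: B rule: less_induct)
  case less
  consider "card B = 4" | "card B = 6" | "8 \<le> card B"
    using less.prems(5,6) by atomize_elim presburger
  then show ?case
  proof cases
    case 1
    then show ?thesis
      using less.prems by (intro a2p_decomposable_bipartite_cong_card[OF a2p_decomposable_bipartite_4_4]) auto
  next
    case 2
    then show ?thesis
      using less.prems by (intro a2p_decomposable_bipartite_cong_card[OF a2p_decomposable_bipartite_4_6]) auto
  next
    case 3
    then obtain C where C: "C \<subseteq> B" "card C = 4" "finite C"
      using obtain_subset_with_card_n[of 4 B] by auto
    have D: "card (B - C) = card B - 4" using C by (simp add: card_Diff_subset)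
    have "a2p_decomposable (bipartite_edges A C)"
      using less.prems C 3 by (intro less.hyps) auto
    moreover have "a2p_decomposable (bipartite_edges A (B - C))"
      using less.prems C D 3 by (intro less.hyps) auto
    ultimately have "a2p_decomposable (bipartite_edges A (C \<union> (B - C)))"
      using less.prems(3) C by (intro a2p_decomposable_bipartite_Un) auto
    moreover have "C \<union> (B - C) = B" using C by auto
    ultimately show ?thesis by simp
  qed
qed

text \<open>Cutting \<open>A\<close> into blocks of size 4 reduces to
  \<open>a2p_decomposable_bipartite_4\<close>.\<close>

lemma a2p_decomposable_bipartite:
  assumes "finite A" "finite B" "A \<inter> B = {}" "4 dvd card A" "even (card B)" "4 \<le> card B"
  shows "a2p_decomposable (bipartite_edges A B)"
  using assms
proof (induction "card A" arbitrary: A rule: less_induct)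
  case less
  show ?case
  proof (cases "A = {}")
    case True
    then show ?thesis by (simp add: bipartite_edges_def a2p_decomposable_empty)
  next
    case False
    then have "4 \<le> card A" using less.prems by (simp add: dvd_imp_le card_gt_0_iff)
    then obtain C where C: "C \<subseteq> A" "card C = 4" "finite C"
      using obtain_subset_with_card_n[of 4 A] by auto
    have D: "card (A - C) = card A - 4" using C by (simp add: card_Diff_subset)
    have "a2p_decomposable (bipartite_edges C B)"
      using less.prems C by (intro a2p_decomposable_bipartite_4) auto
    moreover have "a2p_decomposable (bipartite_edges (A - C) B)"
      using less.prems C D \<open>4 \<le> card A\<close> by (intro less.hyps) (auto intro: dvd_diff_nat)
    \<comment> \<open>The union lemma splits the second part, so the two parts are swapped.\<close>
    ultimately have "a2p_decomposable (bipartite_edges B (C \<union> (A - C)))"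
      using less.prems(3) C
      by (intro a2p_decomposable_bipartite_Un) (auto simp: bipartite_edges_commute[of B])
    moreover have "C \<union> (A - C) = A" using C by auto
    ultimately show ?thesis by (simp add: bipartite_edges_commute[of B])
  qed
qed

section \<open>Recursions in the number of points\<close>

text \<open>The \<open>k\<close> new points share the old point 0 with the other packing. The
  crossing edges then join \<open>k\<close> points to the remaining \<open>m - 1\<close> old ones,
  an even number that is at least 4.\<close>

lemma a2p_packable_extend_odd:
  fixes m k :: nat
  assumes m: "a2p_packable {..<m} l" "odd m" "5 \<le> m"
    and k: "a2p_packable {..<Suc k} l'" "4 dvd k"
  shows "a2p_packable {..<m + k} (l + l')"
proof -
  let ?Y = "insert 0 {m..<m + k}"
  have "a2p_packable ?Y l'"
    using a2p_packable_cong_card[OF k(1), of ?Y] m(3) by simp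
  moreover have "a2p_decomposable (bipartite_edges ({..<m} - ?Y) (?Y - {..<m}))"
  proof -
    have "{..<m} - ?Y = {1..<m}" "?Y - {..<m} = {m..<m + k}" using m(3) by auto
    moreover have "a2p_decomposable (bipartite_edges {m..<m + k} {1..<m})"
      using m k by (intro a2p_decomposable_bipartite) auto
    ultimately show ?thesis by (simp add: bipartite_edges_commute[of "{Suc 0..<m}"])
  qed
  ultimately have "a2p_packable ({..<m} \<union> ?Y) (l + l')"
    using m by (intro a2p_packable_Un[where p = 0]) auto
  moreover have "{..<m} \<union> ?Y = {..<m + k}" using m(3) by auto
  ultimately show ?thesis by simp
qed

lemma a2p_packable_extend_even:
  fixes m k :: nat
  assumes m: "a2p_packable {..<m} l" "even m" "4 \<le> m"
    and k: "a2p_packable {..<k} l'" "4 dvd k"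
  shows "a2p_packable {..<m + k} (l + l')"
proof -
  let ?Y = "{m..<m + k}"
  have "a2p_packable ?Y l'"
    using a2p_packable_cong_card[OF k(1), of ?Y] by simp
  moreover have "a2p_decomposable (bipartite_edges ({..<m} - ?Y) (?Y - {..<m}))"
  proof -
    have "{..<m} - ?Y = {..<m}" "?Y - {..<m} = {m..<m + k}" by auto
    moreover have "a2p_decomposable (bipartite_edges {m..<m + k} {..<m})"
      using m k by (intro a2p_decomposable_bipartite) auto
    ultimately show ?thesis by (simp add: bipartite_edges_commute[of "{..<m}"])
  qed
  ultimately have "a2p_packable ({..<m} \<union> ?Y) (l + l')"
    \<comment> \<open>The two sets are disjoint here, so the choice of \<open>p\<close> is
      arbitrary.\<close>
    using m by (intro a2p_packable_Un[where p = 0]) auto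
  moreover have "{..<m} \<union> ?Y = {..<m + k}" by auto
  ultimately show ?thesis by simp
qed

text \<open>Packings on 13 and 9 points share one point, and their leaves have 6 + 4 edges.\<close>

lemma a2p_packable_21: "a2p_packable {..<21::nat} 10"
  using a2p_packable_extend_odd[OF a2p_packable_13, of 8 4] a2p_packable_9 by simp

text \<open>The bound on \<open>l\<close> expresses optimality: a leave has at least
  \<open>n / 2\<close> edges and its size is fixed modulo 8. Eight more points raise both sides by
  4.\<close>

lemma a2p_packable_even:
  fixes n :: nat
  assumes "even n" "8 \<le> n"
  shows "\<exists>l < n div 2 + 8. a2p_packable {..<n} l"
  using assms
proof (induction n rule: less_induct)
  case (less n)
  show ?case
  proof (cases "16 \<le> n")
    case True
    then have "8 \<le> n - 8" by simp
    then obtain l where l: "l < (n - 8) div 2 + 8" "a2p_packable {..<n - 8} l"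
      using less.IH[of "n - 8"] less.prems by fastforce
    have "a2p_packable {..<n - 8 + 8} (l + 4)"
      using l less.prems True a2p_packable_8 by (intro a2p_packable_extend_even) auto
    moreover have "l + 4 < n div 2 + 8" using l True by auto
    ultimately show ?thesis using True by (intro exI[of _ "l + 4"]) simp
  next
    case False
    then consider "n = 8" | "n = 10" | "n = 12" | "n = 14"
      using less.prems by atomize_elim presburger
    then show ?thesis
      using a2p_packable_8 a2p_packable_10 a2p_packable_12 a2p_packable_14
      by cases (force intro: exI)+
  qed
qed

text \<open>The values of \<open>l\<close> are chosen for optimality: subtracting 8 gives a negative
  number, or 1 or 2, which even degrees forbid; only 8 itself could drop to 0. Sixteen more points
  leave \<open>l\<close> unchanged because the packing on 17 points has an empty leave.\<close>

lemma a2p_packable_odd: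
  fixes n :: nat
  assumes "odd n" "8 \<le> n"
  shows "\<exists>l \<le> 10. l \<noteq> 8 \<and> a2p_packable {..<n} l"
  using assms
proof (induction n rule: less_induct)
  case (less n)
  show ?case
  proof (cases "24 \<le> n")
    case True
    then have "8 \<le> n - 16" by simp
    then obtain l where l: "l \<le> 10" "l \<noteq> 8" "a2p_packable {..<n - 16} l"
      using less.IH[of "n - 16"] less.prems by fastforce
    have "a2p_packable {..<n - 16 + 16} (l + 0)"
      using l less.prems True a2p_packable_17 by (intro a2p_packable_extend_odd) auto
    then show ?thesis using l True by (intro exI[of _ l]) simp
  next
    case False
    then consider "n = 9" | "n = 11" | "n = 13" | "n = 15" | "n = 17" | "n = 19" | "n = 21" | "n = 23"
      using less.prems by atomize_elim presburger
    then show ?thesis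
    proof cases
      case 1
      then show ?thesis using a2p_packable_9 by (intro exI[of _ 4]) simp
    next
      case 2
      then show ?thesis using a2p_packable_11 by (intro exI[of _ 7]) simp
    next
      case 3
      then show ?thesis using a2p_packable_13 by (intro exI[of _ 6]) simp
    next
      case 4
      then show ?thesis using a2p_packable_15 by (intro exI[of _ 9]) simp
    next
      case 5
      then show ?thesis using a2p_packable_17 by (intro exI[of _ 0]) simp
    next
      case 6
      then show ?thesis using a2p_packable_19 by (intro exI[of _ 3]) simp
    next
      case 7
      then show ?thesis using a2p_packable_21 by (intro exI[of _ 10]) simp
    next
      case 8
      then show ?thesis using a2p_packable_23 by (intro exI[of _ 5]) simp
    qed
  qed
qed

section \<open>Lower bounds for the leave\<close>

text \<open>Each position \<open>i\<close> with \<open>v i = x\<close> is counted twice, once for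
  each of the two edges that meet there.\<close>

lemma is_8cycle_degree:
  assumes "is_8cycle C"
  shows "card C = 8" "even (card {e \<in> C. x \<in> e})"
proof -
  obtain v :: "nat \<Rightarrow> 'a" where v: "inj_on v {0..<8}" "C = {{v i, v ((i + 1) mod 8)} | i. i < 8}"
    using assms unfolding is_8cycle_def by blast
  define E where "E i = {v i, v ((i + 1) mod 8)}" for i :: nat
  have vv: "v i = v j \<longleftrightarrow> i = j" if "i < 8" "j < 8" for i j
    using v(1) that by (auto simp: inj_on_def)
  have inj: "inj_on E {..<8}"
  proof (rule inj_onI)
    fix i j :: nat assume ij: "i \<in> {..<8}" "j \<in> {..<8}" "E i = E j"
    \<comment> \<open>Different positions with the same edge would each be the successor of the
      other, which is impossible modulo 8.\<close>
    then have "i = j \<or> (i = (j + 1) mod 8 \<and> (i + 1) mod 8 = j)"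
      by (auto simp: E_def doubleton_eq_iff vv)
    then show "i = j" using ij(1,2) by (auto simp: mod_Suc split: if_splits)
  qed
  have C: "C = E ` {..<8}" unfolding v(2) E_def by auto
  \<comment> \<open>The shift by one permutes the residues modulo 8.\<close>
  have shift: "(\<Sum>i<8. g ((i + 1) mod 8)) = (\<Sum>i<8. g i)" for g :: "nat \<Rightarrow> nat"
    by (simp add: lessThan_nat_numeral) (simp add: numeral_2_eq_2)
  show "card C = 8" unfolding C using inj by (simp add: card_image)
  have "{e \<in> C. x \<in> e} = E ` {i \<in> {..<8}. x \<in> E i}" unfolding C by auto
  then have "card {e \<in> C. x \<in> e} = card {i \<in> {..<8}. x \<in> E i}"
    by (simp only:) (rule card_image, rule inj_on_subset[OF inj], blast)
  also have "\<dots> = (\<Sum>i<8. of_bool (x \<in> E i))"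
    by (simp add: Int_def flip: sum.inter_filter)
  also have "\<dots> = (\<Sum>i<8. of_bool (x = v i) + of_bool (x = v ((i + 1) mod 8)))"
  proof (rule sum.cong)
    fix i :: nat assume "i \<in> {..<8}"
    then have "i < 8" "(i + 1) mod 8 < 8" "i \<noteq> (i + 1) mod 8" by (auto simp: mod_Suc)
    then have "v i \<noteq> v ((i + 1) mod 8)" using vv by blast
    then show "of_bool (x \<in> E i) = (of_bool (x = v i) + of_bool (x = v ((i + 1) mod 8)) :: nat)"
      by (auto simp: E_def)
  qed simp
  also have "\<dots> = 2 * (\<Sum>i<8. of_bool (x = v i))"
    unfolding sum.distrib by (subst shift) simp
  finally show "even (card {e \<in> C. x \<in> e})" by simp
qed

lemma complete_edges_degree:
  assumes "finite X" "x \<in> X"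
  shows "card {e \<in> complete_edges X. x \<in> e} = card X - 1"
proof -
  have "{e \<in> complete_edges X. x \<in> e} = (\<lambda>y. {x, y}) ` (X - {x})"
    using assms(2) by (auto elim!: in_complete_edgesE simp: doubleton_in_complete_edges)
  moreover have "inj_on (\<lambda>y. {x, y}) (X - {x})" by (auto simp: inj_on_def doubleton_eq_iff)
  ultimately show ?thesis using assms by (simp add: card_image)
qed

text \<open>The cycles are disjoint with 8 edges each, which fixes the size of the leave modulo 8.
  They take an even number of edges from the degree \<open>card X - 1\<close> of each
  vertex.\<close>

lemma packing_leave:
  assumes X: "finite X" and P: "is_8cycle_packing X CC L"
  shows "card (complete_edges X) = card L + 8 * card CC"
    and "x \<in> X \<Longrightarrow> even (card {e \<in> L. x \<in> e}) \<longleftrightarrow> odd (card X)"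
proof -
  have cyc: "is_8cycle C" "C \<subseteq> complete_edges X" if "C \<in> CC" for C
    using P that unfolding is_8cycle_packing_def by auto
  have dj: "C1 \<inter> C2 = {}" if "C1 \<in> CC" "C2 \<in> CC" "C1 \<noteq> C2" for C1 C2
    using P that unfolding is_8cycle_packing_def by blast
  have L: "L = complete_edges X - \<Union>CC" using P unfolding is_8cycle_packing_def by simp
  have finK: "finite (complete_edges X)" using X by (rule finite_complete_edges)
  have fin: "finite CC" using cyc(2) finK by (meson PowI finite_Pow_iff finite_subset subsetI)
  have finC: "finite C" if "C \<in> CC" for C using cyc(2)[OF that] finK finite_subset by blast
  have finU: "finite (\<Union>CC)" using fin finC by blast
  have "card (\<Union>CC) = (\<Sum>C\<in>CC. card C)"
    using dj finC by (intro card_Union_disjoint) (auto simp: pairwise_def disjnt_def)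
  also have "\<dots> = 8 * card CC" by (simp add: is_8cycle_degree(1) cyc(1))
  finally have U: "card (\<Union>CC) = 8 * card CC" .
  have sub: "\<Union>CC \<subseteq> complete_edges X" using cyc(2) by blast
  show "card (complete_edges X) = card L + 8 * card CC"
    using U sub finU finK unfolding L
    by (metis card_Diff_subset card_mono le_add_diff_inverse2)
  assume x: "x \<in> X"
  have "card {e \<in> \<Union>CC. x \<in> e} = card (\<Union>C\<in>CC. {e \<in> C. x \<in> e})"
    by (rule arg_cong[of _ _ card]) auto
  also have "\<dots> = (\<Sum>C\<in>CC. card {e \<in> C. x \<in> e})"
    using dj finC fin by (intro card_UN_disjoint) auto
  finally have ev: "even (card {e \<in> \<Union>CC. x \<in> e})"
    by (simp add: dvd_sum is_8cycle_degree(2) cyc(1))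
  have "{e \<in> complete_edges X. x \<in> e} = {e \<in> L. x \<in> e} \<union> {e \<in> \<Union>CC. x \<in> e}"
    unfolding L using sub by auto
  moreover have "card \<dots> = card {e \<in> L. x \<in> e} + card {e \<in> \<Union>CC. x \<in> e}"
    using finU finK by (intro card_Un_disjoint) (auto simp: L intro: finite_subset[OF _ finU])
  ultimately have "card X - 1 = card {e \<in> L. x \<in> e} + card {e \<in> \<Union>CC. x \<in> e}"
    using complete_edges_degree[OF X x] by metis
  \<comment> \<open>Excludes truncation in \<open>card X - 1\<close>, so that parities can be
    compared.\<close>
  moreover have "card X \<noteq> 0" using X x by auto
  ultimately show "even (card {e \<in> L. x \<in> e}) \<longleftrightarrow> odd (card X)"
    using ev by (metis One_nat_def Suc_pred even_Suc even_add neq0_conv)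
qed

text \<open>Every vertex has odd degree in the leave, so the leave covers \<open>X\<close>, and one
  edge covers only two vertices.\<close>

lemma packing_leave_even:
  assumes X: "finite X" "even (card X)" and P: "is_8cycle_packing X CC L"
  shows "card X \<le> 2 * card L"
proof -
  have sub: "L \<subseteq> complete_edges X" using P unfolding is_8cycle_packing_def by auto
  have "X \<subseteq> \<Union>L"
  proof
    fix x assume "x \<in> X"
    then have "odd (card {e \<in> L. x \<in> e})" using packing_leave(2)[OF X(1) P] X(2) by blast
    then have "{e \<in> L. x \<in> e} \<noteq> {}" by (metis card.empty even_zero)
    then show "x \<in> \<Union>L" by blast
  qed
  moreover have e: "e \<subseteq> X" "card e = 2" if "e \<in> L" for e
    using that sub unfolding complete_edges_def by auto
  then have "\<Union>L \<subseteq> X" by blast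
  ultimately have "card X = card (\<Union>L)" by (simp add: subset_antisym)
  also have "\<dots> \<le> (\<Sum>e\<in>L. card e)" by (rule card_Union_le_sum_card)
  also have "\<dots> = 2 * card L" using e by simp
  finally show ?thesis .
qed

text \<open>Even degrees rule out vertices of degree 1, but a graph with one or two edges has such a
  vertex.\<close>

lemma packing_leave_odd:
  assumes X: "finite X" "odd (card X)" and P: "is_8cycle_packing X CC L"
  shows "card L \<noteq> 1" "card L \<noteq> 2"
proof -
  have sub: "L \<subseteq> complete_edges X" using P unfolding is_8cycle_packing_def by auto
  have ev: "even (card {e \<in> L. x \<in> e})" if "x \<in> X" for x
    using packing_leave(2)[OF X(1) P that] X(2) by blast
  have no_leaf: False if "e \<in> L" "x \<in> e" "\<And>d. d \<in> L \<Longrightarrow> x \<in> d \<Longrightarrow> d = e" for e x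
  proof -
    have "{d \<in> L. x \<in> d} = {e}" using that by blast
    moreover have "x \<in> X" using that sub unfolding complete_edges_def by blast
    ultimately show False using ev by fastforce
  qed
  have edge: "card e = 2" if "e \<in> L" for e using that sub unfolding complete_edges_def by blast
  show "card L \<noteq> 1"
  proof
    assume "card L = 1"
    then obtain e where "L = {e}" by (auto simp: card_1_singleton_iff)
    moreover from this obtain x where "x \<in> e" using edge by fastforce
    ultimately show False using no_leaf by blast
  qed
  show "card L \<noteq> 2"
  proof
    assume "card L = 2"
    then obtain d e where de: "L = {d, e}" "d \<noteq> e" by (auto simp: card_2_iff)
    have "finite e" using edge[of e] de by (auto intro: card_ge_0_finite)
    \<comment> \<open>Two different sets of size 2 are not nested, so \<open>d\<close> has an
      endpoint outside \<open>e\<close>, of degree 1 in \<open>L\<close>.\<close>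
    then have "\<not> d \<subseteq> e" using card_subset_eq[of e d] edge de by auto
    then obtain x where "x \<in> d" "x \<notin> e" by blast
    then show False using no_leaf[of d x] de by blast
  qed
qed

section \<open>From decompositions to maximum A2P packings\<close>

text \<open>Cycles and inside cycles both have union \<open>G\<close>, so both packings have the
  leave \<open>complete_edges X - G\<close>.\<close>

lemma a2p_packable_imp_A2P:
  assumes "a2p_packable X l"
  shows "\<exists>CC L. is_A2P X CC L \<and> card L = l"
proof -
  obtain G where G: "G \<subseteq> complete_edges X" "a2p_decomposable G" "card (complete_edges X - G) = l"
    using assms unfolding a2p_packable_def by blast
  obtain CC f where f: "\<And>C. C \<in> CC \<Longrightarrow> is_8cycle C \<and> is_inside_8cycle C (f C)"
    "\<And>C1 C2. C1 \<in> CC \<Longrightarrow> C2 \<in> CC \<Longrightarrow> C1 \<noteq> C2 \<Longrightarrow> C1 \<inter> C2 = {} \<and> f C1 \<inter> f C2 = {}"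
    "\<Union>CC = G" "\<Union>(f ` CC) = G"
    using G(2) unfolding a2p_decomposable_def by metis
  let ?L = "complete_edges X - G"
  have sub: "C \<subseteq> complete_edges X" "f C \<subseteq> G" if "C \<in> CC" for C
    using that f(3,4) G(1) by auto
  have "is_8cycle_packing X CC ?L"
    unfolding is_8cycle_packing_def using f(1-3) sub(1) by simp
  moreover have "is_8cycle_packing X (f ` CC) ?L"
    unfolding is_8cycle_packing_def
  proof (intro conjI ballI impI)
    fix D assume "D \<in> f ` CC"
    then show "is_8cycle D" "D \<subseteq> complete_edges X"
      using f(1) sub(2) G(1) unfolding is_inside_8cycle_def by blast+
  next
    fix D1 D2 assume "D1 \<in> f ` CC" "D2 \<in> f ` CC" "D1 \<noteq> D2"
    then show "D1 \<inter> D2 = {}" using f(2) by blast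
  qed (simp add: f(4))
  moreover have "\<forall>C\<in>CC. f C \<inter> ?L = {}" using sub(2) by blast
  ultimately have "is_A2P X CC ?L"
    unfolding is_A2P_def using f(1,2) by (intro conjI exI[of _ f]) simp_all
  then show ?thesis using G(3) by blast
qed

theorem mainTheorem1:
  fixes n :: nat
  assumes "n \<ge> 8"
  shows "\<exists>CC L. is_max_8cycle_packing {..<n} CC L \<and> is_A2P {..<n} CC L"
proof -
  obtain l where l: "a2p_packable {..<n} l"
    "even n \<and> l < n div 2 + 8 \<or> odd n \<and> l \<le> 10 \<and> l \<noteq> 8"
    using a2p_packable_even a2p_packable_odd assms by metis
  then obtain CC L where L: "is_A2P {..<n} CC L" "card L = l"
    using a2p_packable_imp_A2P by blast
  then have P: "is_8cycle_packing {..<n} CC L" unfolding is_A2P_def by blast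
  have "card L \<le> card L'" if P': "is_8cycle_packing {..<n} CC' L'" for CC' L'
  proof (rule ccontr)
    assume less: "\<not> card L \<le> card L'"
    have eq: "card L + 8 * card CC = card L' + 8 * card CC'"
      using packing_leave(1)[OF _ P] packing_leave(1)[OF _ P'] by simp
    \<comment> \<open>The two sizes are congruent modulo 8, so a strictly smaller leave is smaller
      by at least 8.\<close>
    then have ge: "card L' + 8 \<le> card L" using less by presburger
    show False
    proof (cases "even n")
      case True
      then have "n \<le> 2 * card L'" using packing_leave_even[OF _ _ P'] by simp
      then show False using ge l(2) L(2) True by linarith
    next
      case False
      then have "card L' \<noteq> 1" "card L' \<noteq> 2" using packing_leave_odd[OF _ _ P'] by auto
      \<comment> \<open>By \<open>ge\<close> and \<open>l \<le> 10\<close>, \<open>card L'\<close>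
        is at most 2, so only 0 remains. Then \<open>card L\<close> is a multiple of 8 from 8 to 10,
        which is the excluded value 8.\<close>
      then have "card L' = 0" "l \<le> 10" "l \<noteq> 8" using ge l(2) L(2) False by auto
      then show False using eq ge L(2) by presburger
    qed
  qed
  then have "is_max_8cycle_packing {..<n} CC L" unfolding is_max_8cycle_packing_def using P by blast
  then show ?thesis using L(1) by blast
qed

end
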